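(* Let $\mathcal{V}$ be a $d$-dimensional linear subspace of $\mathbb{R}^m$ equipped with the scalar product $(x,y)_A=\langle x,Ay\rangle$, where $A$ is a diagonal positive $m\times m$-matrix, and let $c:[0,\infty)\to\mathcal{V}$ be Lipschitz continuous. Let $c_j^-,c_j^+\in\mathbb{R}$, $j=1,\dots,m$, and $$C=\bigcap_{j=1}^m\{y\in\mathcal{V}: c_j^-\le\langle e_j,Ay\rangle\le c_j^+\},\qquad C(t)=C+c(t).$$ Let $I_0\subset\{-1,1\}\times\{1,\dots,m\}$ be such that the set $$F=\bigcap_{(\alpha,j)\in I_0}\{y\in\mathcal{V}:\langle e_j,Ay\rangle=c_j^\alpha\}$$ is a singleton $\{y_{*,0}\}$ and $y_{*,0}\in C$. Assume that there exists $\varepsilon>0$ such that $$-\dot c(t)+B^A_\varepsilon(0)\subset N^A_C(y_{*,0})\quad\text{for a.a. } t\in[0,\tau_d],\qquad \tau_d=\frac1\varepsilon\cdot\max_{v\in C}\|v-y_{*,0}\|^A .$$ Then every solution $y$ of the sweeping process $-\dot y(t)\in N^A_{C(t)}(y(t))$ with initial condition $y(0)\in C(0)$ satisfies $y(\tau_d)=y_{*,0}+c(\tau_d)$. Furthermore, let $y_*(t)$, $t\ge\tau_d$, be the solution of the sweeping process with the initial condition $y_*(\tau_d)=y_{*,0}+c(\tau_d)$. If $c$ is $T$-periodic with $T\ge\tau_d$, then $y_*$ is a globally one-period stable $T$-periodic solution of the sweeping process.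
   Context: $\langle\cdot,\cdot\rangle$ is the Euclidean scalar product and $e_j$ the standard basis of $\mathbb{R}^m$; $c_j^{\alpha}$ means $c_j^{+}$ for $\alpha=1$ and $c_j^-$ for $\alpha=-1$. $\|x\|^A=\sqrt{\langle x,Ax\rangle}$; $B^A_\varepsilon(0)=\{x\in\mathcal{V}:\|x\|^A\le\varepsilon\}$. For a closed convex $K\subset\mathcal{V}$: $N^A_K(y)=\{x\in\mathcal{V}:\langle x,A(\xi-y)\rangle\le 0\ \forall\xi\in K\}$ if $y\in K$, and $\emptyset$ otherwise. A solution of the sweeping process is a locally absolutely continuous $\mathcal{V}$-valued function with $y(t)\in C(t)$ for all $t$ satisfying the inclusion almost everywhere. "Globally one-period stable $T$-periodic solution" means: $y_*(t+T)=y_*(t)$ for all $t\ge\tau_d$, and every solution $y$ with $y(0)\in C(0)$ coincides with $y_*$ for all $t\ge T$ (i.e. after at most one period). *)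

theory Defs
  imports "HOL-Analysis.Analysis"
begin

definition positive_diagonal :: "real^'m^'m \<Rightarrow> bool" where
  "positive_diagonal A \<longleftrightarrow> (\<forall>i j. i \<noteq> j \<longrightarrow> A $ i $ j = 0) \<and> (\<forall>i. A $ i $ i > 0)"

definition inner_A :: "real^'m^'m \<Rightarrow> real^'m \<Rightarrow> real^'m \<Rightarrow> real" where
  "inner_A A x y = x \<bullet> (A *v y)"

definition norm_A :: "real^'m^'m \<Rightarrow> real^'m \<Rightarrow> real" where
  "norm_A A x = sqrt (inner_A A x x)"

definition cball_A :: "(real^'m) set \<Rightarrow> real^'m^'m \<Rightarrow> real \<Rightarrow> (real^'m) set" where
  "cball_A V A \<epsilon> = {x \<in> V. norm_A A x \<le> \<epsilon>}"

definition normal_cone_A ::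
  "(real^'m) set \<Rightarrow> real^'m^'m \<Rightarrow> (real^'m) set \<Rightarrow> real^'m \<Rightarrow> (real^'m) set" where
  "normal_cone_A V A K y =
     (if y \<in> K then {x \<in> V. \<forall>\<xi>\<in>K. inner_A A x (\<xi> - y) \<le> 0} else {})"

definition constraint_set ::
  "(real^'m) set \<Rightarrow> real^'m^'m \<Rightarrow> ('m \<Rightarrow> real) \<Rightarrow> ('m \<Rightarrow> real) \<Rightarrow> (real^'m) set" where
  "constraint_set V A cm cp =
     (\<Inter>j. {y \<in> V. cm j \<le> inner_A A (axis j 1) y \<and> inner_A A (axis j 1) y \<le> cp j})"

definition moving_set ::
  "(real^'m) set \<Rightarrow> (real \<Rightarrow> real^'m) \<Rightarrow> real \<Rightarrow> (real^'m) set" where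
  "moving_set C c t = {x + c t | x. x \<in> C}"

text \<open>For \<open>\<alpha>\<close> in \<open>{-1, 1}\<close>, this is the bound written \<open>c\<^sub>j\<close> with superscript \<open>\<alpha>\<close>.\<close>
definition bound :: "('m \<Rightarrow> real) \<Rightarrow> ('m \<Rightarrow> real) \<Rightarrow> int \<Rightarrow> 'm \<Rightarrow> real" where
  "bound cm cp \<alpha> j = (if \<alpha> = 1 then cp j else cm j)"

text \<open>The conjunct \<open>y \<in> V\<close> is kept outside the quantifier, so that the empty intersection is \<open>V\<close>.\<close>
definition face_set ::
  "(real^'m) set \<Rightarrow> real^'m^'m \<Rightarrow> ('m \<Rightarrow> real) \<Rightarrow> ('m \<Rightarrow> real) \<Rightarrow> (int \<times> 'm) set \<Rightarrow> (real^'m) set" where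
  "face_set V A cm cp I0 =
     {y \<in> V. \<forall>(\<alpha>, j)\<in>I0. inner_A A (axis j 1) y = bound cm cp \<alpha> j}"

text \<open>Absolute continuity of a function of a real variable (the library's
  \<^const>\<open>absolutely_continuous\<close> is about measures). Degenerate intervals are harmless: they
  contribute nothing to either sum.\<close>
definition abs_continuous_on_interval ::
  "real \<Rightarrow> real \<Rightarrow> (real \<Rightarrow> 'a::real_normed_vector) \<Rightarrow> bool" where
  "abs_continuous_on_interval a b f \<longleftrightarrow>
     (\<forall>\<epsilon>>0. \<exists>\<delta>>0. \<forall>(n::nat) u v.
        (\<forall>i<n. a \<le> u i \<and> u i \<le> v i \<and> v i \<le> b) \<longrightarrow>
        (\<forall>i<n. \<forall>j<n. i \<noteq> j \<longrightarrow> {u i<..<v i} \<inter> {u j<..<v j} = {}) \<longrightarrow>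
        (\<Sum>i<n. v i - u i) < \<delta> \<longrightarrow>
        (\<Sum>i<n. norm (f (v i) - f (u i))) < \<epsilon>)"

definition locally_abs_continuous_from ::
  "real \<Rightarrow> (real \<Rightarrow> 'a::real_normed_vector) \<Rightarrow> bool" where
  "locally_abs_continuous_from t0 f \<longleftrightarrow>
     (\<forall>a b. t0 \<le> a \<longrightarrow> a \<le> b \<longrightarrow> abs_continuous_on_interval a b f)"

text \<open>Solutions on the half-line \<open>[t0, \<infinity>)\<close>; values at times before \<open>t0\<close> are irrelevant.\<close>
definition sweeping_solution ::
  "(real^'m) set \<Rightarrow> real^'m^'m \<Rightarrow> (real \<Rightarrow> (real^'m) set) \<Rightarrow> real \<Rightarrow> (real \<Rightarrow> real^'m) \<Rightarrow> bool" where
  "sweeping_solution V A K t0 y \<longleftrightarrow>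
     locally_abs_continuous_from t0 y \<and>
     (\<forall>t\<ge>t0. y t \<in> V) \<and>
     (\<forall>t\<ge>t0. y t \<in> K t) \<and>
     (AE t in lebesgue. t \<ge> t0 \<longrightarrow>
        (\<exists>y'. (y has_vector_derivative y') (at t within {t0..}) \<and>
              - y' \<in> normal_cone_A V A (K t) (y t)))"

definition globally_one_period_stable_periodic ::
  "(real^'m) set \<Rightarrow> real^'m^'m \<Rightarrow> (real \<Rightarrow> (real^'m) set) \<Rightarrow> real \<Rightarrow> real \<Rightarrow> (real \<Rightarrow> real^'m) \<Rightarrow> bool" where
  "globally_one_period_stable_periodic V A K \<tau> T ys \<longleftrightarrow>
     sweeping_solution V A K \<tau> ys \<and>
     (\<forall>t\<ge>\<tau>. ys (t + T) = ys t) \<and>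
     (\<forall>y. sweeping_solution V A K 0 y \<longrightarrow> y 0 \<in> K 0 \<longrightarrow> (\<forall>t\<ge>T. y t = ys t))"

end

theory Submission
  imports Defs
begin

text \<open>Let \<open>w = y - c - y0\<close>. Testing the inclusion for \<open>y\<close> with \<open>y0 + c\<close> gives
  \<open>(y', w)\<^sub>A \<le> 0\<close>, and testing \<open>- c' + b \<in> N\<^sub>C(y0)\<close> with \<open>y - c\<close>, where \<open>b\<close> is the multiple of
  \<open>w\<close> of norm \<open>\<epsilon>\<close>, gives \<open>(c', w)\<^sub>A \<ge> \<epsilon> \<parallel>w\<parallel>\<close>. Hence \<open>\<parallel>w\<parallel>\<close> decreases at rate at least \<open>\<epsilon>\<close>
  until it vanishes, which happens by time \<open>\<tau>\<close>. Monotonicity of the normal cone makes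
  the distance of two solutions nonincreasing, so solutions that agree at time \<open>\<tau>\<close> agree from then
  on. Periodicity follows since \<open>t \<mapsto> ys (t + T)\<close> is again a solution from time \<open>0\<close>.\<close>

section \<open>Absolutely continuous functions on a compact interval\<close>

text \<open>Bundles the three premises on the intervals in the definition of absolute continuity, so
  that an admissible family is passed between estimates as a single fact.\<close>

definition short_intervals :: "real \<Rightarrow> real \<Rightarrow> real \<Rightarrow> nat \<Rightarrow> (nat \<Rightarrow> real) \<Rightarrow> (nat \<Rightarrow> real) \<Rightarrow> bool" where
  "short_intervals a b \<delta> n u v \<longleftrightarrow>
     (\<forall>i<n. a \<le> u i \<and> u i \<le> v i \<and> v i \<le> b) \<and>
     (\<forall>i<n. \<forall>j<n. i \<noteq> j \<longrightarrow> {u i<..<v i} \<inter> {u j<..<v j} = {}) \<and>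
     (\<Sum>i<n. v i - u i) < \<delta>"

lemma abs_continuous_on_interval_iff:
  fixes f :: "real \<Rightarrow> 'a::real_normed_vector"
  shows "abs_continuous_on_interval a b f \<longleftrightarrow>
    (\<forall>\<epsilon>>0. \<exists>\<delta>>0. \<forall>n u v. short_intervals a b \<delta> n u v \<longrightarrow>
       (\<Sum>i<n. norm (f (v i) - f (u i))) < \<epsilon>)"
  unfolding abs_continuous_on_interval_def short_intervals_def by (simp add: imp_conjL)

lemma abs_continuous_on_intervalD:
  fixes f :: "real \<Rightarrow> 'a::real_normed_vector"
  assumes "abs_continuous_on_interval a b f" "\<epsilon> > 0"
  obtains \<delta> where "\<delta> > 0"
    and "\<And>n u v. short_intervals a b \<delta> n u v \<Longrightarrow> (\<Sum>i<n. norm (f (v i) - f (u i))) < \<epsilon>"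
  using assms unfolding abs_continuous_on_interval_iff by blast

lemma abs_continuous_on_interval_subset:
  fixes f :: "real \<Rightarrow> 'a::real_normed_vector"
  assumes f: "abs_continuous_on_interval a b f" and "a \<le> a'" "b' \<le> b"
  shows "abs_continuous_on_interval a' b' f"
proof -
  have "short_intervals a b \<delta> n u v" if "short_intervals a' b' \<delta> n u v" for \<delta> n u v
    using that assms(2,3) unfolding short_intervals_def by fastforce
  with f show ?thesis
    unfolding abs_continuous_on_interval_iff by meson
qed

text \<open>The sum of increments of \<open>f\<close> is at most a constant times that of
  \<open>g\<close>, so the \<open>\<delta>\<close> for a rescaled \<open>\<epsilon>\<close> works.
  Lipschitz functions, squares and the norm of a curve all inherit absolute continuity in this
  way.\<close>

lemma abs_continuous_on_interval_dominated:
  fixes f :: "real \<Rightarrow> 'a::real_normed_vector" and g :: "real \<Rightarrow> 'b::real_normed_vector"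
  assumes g: "abs_continuous_on_interval a b g"
    and le: "\<And>u v. \<lbrakk>u \<in> {a..b}; v \<in> {a..b}\<rbrakk> \<Longrightarrow> norm (f v - f u) \<le> M * norm (g v - g u)"
  shows "abs_continuous_on_interval a b f"
  unfolding abs_continuous_on_interval_iff
proof (intro allI impI)
  fix \<epsilon> :: real assume "\<epsilon> > 0"
  \<comment> \<open>\<open>M\<close> may be zero or negative; \<open>M'\<close> keeps the bound and
    can be divided by.\<close>
  define M' where "M' = max M 1"
  have "M' > 0" by (simp add: M'_def)
  then have "\<epsilon> / M' > 0" using \<open>\<epsilon> > 0\<close> by simp
  from abs_continuous_on_intervalD[OF g this]
  obtain \<delta> where "\<delta> > 0"
    and \<delta>: "\<And>n u v. short_intervals a b \<delta> n u v \<Longrightarrow> (\<Sum>i<n. norm (g (v i) - g (u i))) < \<epsilon> / M'"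
    by blast
  have "(\<Sum>i<n. norm (f (v i) - f (u i))) < \<epsilon>" if uv: "short_intervals a b \<delta> n u v" for n u v
  proof -
    have "(\<Sum>i<n. norm (f (v i) - f (u i))) \<le> (\<Sum>i<n. M' * norm (g (v i) - g (u i)))"
    proof (rule sum_mono)
      fix i assume "i \<in> {..<n}"
      then have "norm (f (v i) - f (u i)) \<le> M * norm (g (v i) - g (u i))"
        using uv by (intro le) (force simp: short_intervals_def)+
      also have "\<dots> \<le> M' * norm (g (v i) - g (u i))"
        by (intro mult_right_mono) (auto simp: M'_def)
      finally show "norm (f (v i) - f (u i)) \<le> M' * norm (g (v i) - g (u i))" .
    qed
    also have "\<dots> = M' * (\<Sum>i<n. norm (g (v i) - g (u i)))"
      by (simp add: sum_distrib_left)
    also have "\<dots> < M' * (\<epsilon> / M')"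
      using \<delta>[OF uv] \<open>M' > 0\<close> by (intro mult_strict_left_mono) auto
    finally show ?thesis using \<open>M' > 0\<close> by simp
  qed
  then show "\<exists>\<delta>>0. \<forall>n u v. short_intervals a b \<delta> n u v \<longrightarrow>
        (\<Sum>i<n. norm (f (v i) - f (u i))) < \<epsilon>"
    using \<open>\<delta> > 0\<close> by blast
qed

text \<open>A Lipschitz function is dominated by the identity, whose increments sum to the total
  length of the intervals, so that \<open>\<delta> = \<epsilon>\<close> serves for the
  identity.\<close>

lemma abs_continuous_on_interval_lipschitz:
  fixes f :: "real \<Rightarrow> 'a::real_normed_vector"
  assumes "L-lipschitz_on {a..b} f"
  shows "abs_continuous_on_interval a b f"
proof (rule abs_continuous_on_interval_dominated)
  have "(\<Sum>i<n. norm (v i - u i)) < \<delta>"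
    if "short_intervals a b \<delta> n u v" for \<delta> n and u v :: "nat \<Rightarrow> real"
  proof -
    have "(\<Sum>i<n. norm (v i - u i)) = (\<Sum>i<n. v i - u i)"
      using that by (intro sum.cong) (auto simp: short_intervals_def)
    then show ?thesis using that by (simp add: short_intervals_def)
  qed
  then show "abs_continuous_on_interval a b (\<lambda>t::real. t)"
    unfolding abs_continuous_on_interval_iff by blast
  show "norm (f v - f u) \<le> L * norm (v - u)" if "u \<in> {a..b}" "v \<in> {a..b}" for u v
    using lipschitz_onD[OF assms that(2,1)] by (simp add: dist_norm)
qed

lemma abs_continuous_on_interval_diff:
  fixes f g :: "real \<Rightarrow> 'a::real_normed_vector"
  assumes f: "abs_continuous_on_interval a b f" and g: "abs_continuous_on_interval a b g"
  shows "abs_continuous_on_interval a b (\<lambda>t. f t - g t)"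
  unfolding abs_continuous_on_interval_iff
proof (intro allI impI)
  fix \<epsilon> :: real assume "\<epsilon> > 0"
  then have "\<epsilon> / 2 > 0" by simp
  from abs_continuous_on_intervalD[OF f this]
  obtain \<delta>1 where "\<delta>1 > 0"
    and \<delta>1: "\<And>n u v. short_intervals a b \<delta>1 n u v \<Longrightarrow> (\<Sum>i<n. norm (f (v i) - f (u i))) < \<epsilon> / 2"
    by blast
  from abs_continuous_on_intervalD[OF g \<open>\<epsilon> / 2 > 0\<close>]
  obtain \<delta>2 where "\<delta>2 > 0"
    and \<delta>2: "\<And>n u v. short_intervals a b \<delta>2 n u v \<Longrightarrow> (\<Sum>i<n. norm (g (v i) - g (u i))) < \<epsilon> / 2"
    by blast
  have "(\<Sum>i<n. norm ((f (v i) - g (v i)) - (f (u i) - g (u i)))) < \<epsilon>"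
    if "short_intervals a b (min \<delta>1 \<delta>2) n u v" for n u v
  proof -
    from that have "short_intervals a b \<delta>1 n u v" "short_intervals a b \<delta>2 n u v"
      by (auto simp: short_intervals_def)
    note less = add_strict_mono[OF \<delta>1[OF this(1)] \<delta>2[OF this(2)]]
    have "(\<Sum>i<n. norm ((f (v i) - g (v i)) - (f (u i) - g (u i))))
        \<le> (\<Sum>i<n. norm (f (v i) - f (u i)) + norm (g (v i) - g (u i)))"
    proof (rule sum_mono)
      fix i
      show "norm ((f (v i) - g (v i)) - (f (u i) - g (u i)))
          \<le> norm (f (v i) - f (u i)) + norm (g (v i) - g (u i))"
        using norm_triangle_ineq4[of "f (v i) - f (u i)" "g (v i) - g (u i)"]
        by (simp add: algebra_simps)
    qed
    also have "\<dots> < \<epsilon> / 2 + \<epsilon> / 2"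
      unfolding sum.distrib by (rule less)
    finally show ?thesis by simp
  qed
  then show "\<exists>\<delta>>0. \<forall>n u v. short_intervals a b \<delta> n u v \<longrightarrow>
        (\<Sum>i<n. norm ((f (v i) - g (v i)) - (f (u i) - g (u i)))) < \<epsilon>"
    using \<open>\<delta>1 > 0\<close> \<open>\<delta>2 > 0\<close> by (intro exI[of _ "min \<delta>1 \<delta>2"]) auto
qed

lemma abs_continuous_on_interval_imp_continuous_on:
  fixes f :: "real \<Rightarrow> 'a::real_normed_vector"
  assumes f: "abs_continuous_on_interval a b f"
  shows "continuous_on {a..b} f"
  unfolding continuous_on_iff
proof (intro ballI allI impI)
  fix x \<epsilon> :: real assume x: "x \<in> {a..b}" and "\<epsilon> > 0"
  from abs_continuous_on_intervalD[OF f \<open>\<epsilon> > 0\<close>]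
  obtain \<delta> where "\<delta> > 0"
    and \<delta>: "\<And>n u v. short_intervals a b \<delta> n u v \<Longrightarrow> (\<Sum>i<n. norm (f (v i) - f (u i))) < \<epsilon>"
    by blast
  have "dist (f x') (f x) < \<epsilon>" if x': "x' \<in> {a..b}" "dist x' x < \<delta>" for x'
  proof -
    \<comment> \<open>A family of one interval; \<open>min\<close> and \<open>max\<close> order its
      endpoints, as \<open>x'\<close> may lie on either side of \<open>x\<close>.\<close>
    have "short_intervals a b \<delta> 1 (\<lambda>_. min x x') (\<lambda>_. max x x')"
      using x x' by (auto simp: short_intervals_def dist_real_def min_def max_def)
    from \<delta>[OF this] show ?thesis
      by (cases "x \<le> x'") (auto simp: dist_norm norm_minus_commute)
  qed
  then show "\<exists>\<delta>>0. \<forall>x'\<in>{a..b}. dist x' x < \<delta> \<longrightarrow> dist (f x') (f x) < \<epsilon>"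
    using \<open>\<delta> > 0\<close> by blast
qed

lemma abs_continuous_on_interval_shift:
  fixes f :: "real \<Rightarrow> 'a::real_normed_vector"
  assumes f: "abs_continuous_on_interval (a + T) (b + T) f"
  shows "abs_continuous_on_interval a b (\<lambda>t. f (t + T))"
  unfolding abs_continuous_on_interval_iff
proof (intro allI impI)
  fix \<epsilon> :: real assume "\<epsilon> > 0"
  from abs_continuous_on_intervalD[OF f this]
  obtain \<delta> where "\<delta> > 0"
    and \<delta>: "\<And>n u v. short_intervals (a + T) (b + T) \<delta> n u v \<Longrightarrow>
      (\<Sum>i<n. norm (f (v i) - f (u i))) < \<epsilon>"
    by blast
  have "(\<Sum>i<n. norm (f (v i + T) - f (u i + T))) < \<epsilon>"
    if uv: "short_intervals a b \<delta> n u v" for n u v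
  proof -
    have "{u i + T<..<v i + T} \<inter> {u j + T<..<v j + T} = {}" if "i < n" "j < n" "i \<noteq> j" for i j
    proof (rule equals0I)
      fix x assume "x \<in> {u i + T<..<v i + T} \<inter> {u j + T<..<v j + T}"
      then have "x - T \<in> {u i<..<v i} \<inter> {u j<..<v j}" by auto
      then show False using uv that unfolding short_intervals_def by blast
    qed
    then have "short_intervals (a + T) (b + T) \<delta> n (\<lambda>i. u i + T) (\<lambda>i. v i + T)"
      using uv by (simp add: short_intervals_def)
    then show ?thesis by (rule \<delta>)
  qed
  then show "\<exists>\<delta>>0. \<forall>n u v. short_intervals a b \<delta> n u v \<longrightarrow>
        (\<Sum>i<n. norm (f (v i + T) - f (u i + T))) < \<epsilon>"
    using \<open>\<delta> > 0\<close> by blast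
qed

text \<open>With \<open>h = w v - w u\<close>, the increment splits as
  \<open>B h (w v) + B (w u) h\<close>. Since \<open>w\<close> is bounded on the compact interval,
  this is at most a constant times the norm of \<open>h\<close>, and domination by \<open>w\<close>
  applies.\<close>

lemma abs_continuous_on_interval_bilinear_square:
  fixes w :: "real \<Rightarrow> 'a::real_normed_vector" and B :: "'a \<Rightarrow> 'a \<Rightarrow> 'b::real_normed_vector"
  assumes B: "bounded_bilinear B" and w: "abs_continuous_on_interval a b w"
  shows "abs_continuous_on_interval a b (\<lambda>t. B (w t) (w t))"
proof -
  interpret B: bounded_bilinear B by (rule B)
  obtain K where "K \<ge> 0" and K: "\<And>x y. norm (B x y) \<le> norm x * norm y * K"
    using B.nonneg_bounded by blast
  have "compact (w ` {a..b})"
    by (intro compact_continuous_image abs_continuous_on_interval_imp_continuous_on w) simp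
  then obtain M where M: "\<And>t. t \<in> {a..b} \<Longrightarrow> norm (w t) \<le> M"
    using compact_imp_bounded bounded_iff by (metis imageI)
  show ?thesis
  proof (rule abs_continuous_on_interval_dominated[OF w])
    fix u v assume uv: "u \<in> {a..b}" "v \<in> {a..b}"
    define h where "h = w v - w u"
    have "B (w v) (w v) - B (w u) (w u) = B h (w v) + B (w u) h"
      by (simp add: h_def B.diff_left B.diff_right)
    then have "norm (B (w v) (w v) - B (w u) (w u)) \<le> norm (B h (w v)) + norm (B (w u) h)"
      by (simp add: norm_triangle_ineq)
    also have "\<dots> \<le> norm h * norm (w v) * K + norm (w u) * norm h * K"
      by (intro add_mono K)
    also have "\<dots> \<le> norm h * M * K + M * norm h * K"
      using M uv \<open>K \<ge> 0\<close> by (intro add_mono mult_mono mult_left_mono mult_right_mono)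
        (auto intro: mult_nonneg_nonneg order_trans[OF norm_ge_zero])
    finally show "norm (B (w v) (w v) - B (w u) (w u)) \<le> (2 * M * K) * norm (w v - w u)"
      by (simp add: h_def algebra_simps)
  qed
qed

section \<open>Null sets, and monotonicity from the sign of the derivative almost everywhere\<close>

text \<open>Lebesgue measure is complete, so the exceptional set is itself a null set. This gives
  access to translation invariance of negligible sets and to outer approximation by open
  sets.\<close>

lemma AE_lebesgue_iff_negligible:
  fixes P :: "'a::euclidean_space \<Rightarrow> bool"
  shows "(AE x in lebesgue. P x) \<longleftrightarrow> negligible {x. \<not> P x}"
proof
  assume "AE x in lebesgue. P x"
  then obtain N where "{x. \<not> P x} \<subseteq> N" "N \<in> null_sets lebesgue"
    by (auto simp: eventually_ae_filter)
  then show "negligible {x. \<not> P x}"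
    using negligible_iff_null_sets negligible_subset by blast
next
  assume "negligible {x. \<not> P x}"
  then show "AE x in lebesgue. P x"
    by (intro AE_I'[of "{x. \<not> P x}"]) (auto simp: negligible_iff_null_sets)
qed

lemma AE_lebesgue_shift:
  fixes P :: "real \<Rightarrow> bool"
  assumes "AE t in lebesgue. P t"
  shows "AE t in lebesgue. P (t + T)"
proof -
  have "(+) (-T) ` {t. \<not> P t} = {t. \<not> P (t + T)}"
  proof (intro equalityI subsetI)
    fix t assume "t \<in> {t. \<not> P (t + T)}"
    then show "t \<in> (+) (-T) ` {t. \<not> P t}"
      by (intro image_eqI[of _ _ "t + T"]) auto
  qed auto
  then show ?thesis
    using assms negligible_translation[of "{t. \<not> P t}" "-T"]
    by (simp add: AE_lebesgue_iff_negligible)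
qed

text \<open>On a sufficiently fine tagged division, intervals tagged at a point of differentiability
  contribute almost nothing positive, and the remaining ones have small total length, so that
  absolute continuity controls their contribution.\<close>

lemma abs_continuous_on_interval_antimono:
  fixes f :: "real \<Rightarrow> real"
  assumes "a \<le> b" and f: "abs_continuous_on_interval a b f"
    and deriv: "AE t in lebesgue. t \<in> {a..b} \<longrightarrow>
      (\<exists>f'\<le>0. (f has_real_derivative f') (at t within {a..b}))"
  shows "f b \<le> f a"
proof (rule field_le_epsilon)
  fix e :: real assume "e > 0"
  define N where "N = {t. \<not> (t \<in> {a..b} \<longrightarrow> (\<exists>f'\<le>0. (f has_real_derivative f') (at t within {a..b})))}"
  have N: "N \<in> null_sets lebesgue"
    using deriv by (simp add: N_def AE_lebesgue_iff_negligible negligible_iff_null_sets)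
  from \<open>e > 0\<close> have "e / 2 > 0" by simp
  from abs_continuous_on_intervalD[OF f this]
  obtain \<delta> where "\<delta> > 0"
    and \<delta>: "\<And>n u v. short_intervals a b \<delta> n u v \<Longrightarrow> (\<Sum>i<n. norm (f (v i) - f (u i))) < e / 2"
    by blast
  \<comment> \<open>The open set \<open>U\<close> absorbs the pieces tagged in the exceptional set
    \<open>N\<close>; as \<open>N\<close> is null, \<open>U\<close> itself has measure below
    \<open>\<delta>\<close>.\<close>
  obtain U where U: "open U" "N \<subseteq> U" "emeasure lebesgue (U - N) < ennreal \<delta>"
    using sets_lebesgue_outer_open[OF null_setsD2[OF N] \<open>\<delta> > 0\<close>] by blast
  have U_sets: "U \<in> sets lebesgue" using U(1) by (simp add: borel_open)
  have U_less: "emeasure lebesgue U < ennreal \<delta>"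
    using U(3) emeasure_Diff_null_set[OF N U_sets] by simp
  \<comment> \<open>Chosen so that \<open>e' * (b - a) \<le> e / 2\<close>; the added 1 keeps the
    denominator positive when \<open>a = b\<close>.\<close>
  define e' where "e' = e / (2 * (b - a + 1))"
  have "e' > 0" using \<open>e > 0\<close> \<open>a \<le> b\<close> by (simp add: e'_def)
  \<comment> \<open>The radius of the gauge at \<open>x\<close>: at a point of \<open>N\<close> the
    ball stays inside \<open>U\<close>, at a good point every interval around \<open>x\<close>
    within the ball has slope at most \<open>e'\<close>.\<close>
  have "\<exists>d>0. (x \<in> N \<longrightarrow> ball x d \<subseteq> U) \<and>
      (x \<in> {a..b} - N \<longrightarrow> (\<forall>u v. u \<in> {a..b} \<and> v \<in> {a..b} \<and> u \<in> ball x d \<and> v \<in> ball x d \<and> u \<le> x \<and> x \<le> v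
         \<longrightarrow> f v - f u \<le> e' * (v - u)))" for x
  proof (cases "x \<in> N")
    case True
    then show ?thesis using U(1,2) open_contains_ball by blast
  next
    case notN: False
    show ?thesis
    proof (cases "x \<in> {a..b}")
      case True
      then obtain f' where "f' \<le> 0" "(f has_real_derivative f') (at x within {a..b})"
        using notN by (auto simp: N_def)
      then obtain d where "d > 0" and d: "\<And>y. \<lbrakk>y \<in> {a..b}; norm (y - x) < d\<rbrakk>
          \<Longrightarrow> norm (f y - f x - f' * (y - x)) \<le> e' * norm (y - x)"
        using \<open>e' > 0\<close> unfolding has_field_derivative_def has_derivative_within_alt by blast
      have "f v - f u \<le> e' * (v - u)"
        if "u \<in> {a..b}" "v \<in> {a..b}" "u \<in> ball x d" "v \<in> ball x d" "u \<le> x" "x \<le> v" for u v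
      proof -
        \<comment> \<open>The increment is split at the tag \<open>x\<close>. The linear parts add
          up to \<open>f' * (v - u) \<le> 0\<close>, the two errors to at most
          \<open>e' * (v - u)\<close>.\<close>
        have "f v - f x - f' * (v - x) \<le> e' * (v - x)"
          using d[of v] that by (auto simp: dist_real_def)
        moreover have "- (f u - f x - f' * (u - x)) \<le> e' * (x - u)"
          using d[of u] that by (auto simp: dist_real_def)
        moreover have "f' * (v - x) \<le> 0" "f' * (x - u) \<le> 0"
          using \<open>f' \<le> 0\<close> that by (auto simp: mult_nonpos_nonneg)
        ultimately show ?thesis by (simp add: algebra_simps)
      qed
      then show ?thesis using \<open>d > 0\<close> notN by blast
    qed (use notN in \<open>auto intro: exI[of _ 1]\<close>)
  qed
  then obtain d where d_pos: "\<And>x. d x > 0"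
    and d_bad: "\<And>x. x \<in> N \<Longrightarrow> ball x (d x) \<subseteq> U"
    and d_good: "\<And>x u v. \<lbrakk>x \<in> {a..b} - N; u \<in> {a..b}; v \<in> {a..b}; u \<in> ball x (d x); v \<in> ball x (d x);
        u \<le> x; x \<le> v\<rbrakk> \<Longrightarrow> f v - f u \<le> e' * (v - u)"
    by metis
  obtain p where p: "p tagged_division_of {a..b}" and fine: "(\<lambda>x. ball x (d x)) fine p"
    using fine_division_exists_real[of "\<lambda>x. ball x (d x)"] d_pos by (auto simp: gauge_ball_dependent)
  have p_fin: "finite p" using p by blast
  have p_int: "K = {Inf K..Sup K} \<and> a \<le> Inf K \<and> Inf K \<le> x \<and> x \<le> Sup K \<and> Sup K \<le> b \<and> K \<subseteq> ball x (d x)"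
    if xK: "(x, K) \<in> p" for x K
  proof -
    obtain u v where K: "K = {u..v}" using tagged_division_ofD(4)[OF p xK] by auto
    have "x \<in> K" "K \<subseteq> {a..b}" using tagged_division_ofD(2,3)[OF p xK] by auto
    then show ?thesis using K fine xK by (auto simp: fine_def)
  qed
  define bad where "bad = {(x, K) \<in> p. x \<in> N}"
  have bad: "bad \<subseteq> p" by (auto simp: bad_def)
  have fin_bad: "finite bad" using bad p_fin finite_subset by blast
  \<comment> \<open>The bad pieces are enumerated because absolute continuity is stated for families
    indexed by \<open>i < n\<close>.\<close>
  obtain h n where h: "bij_betw h {..<n::nat} bad"
    using ex_bij_betw_nat_finite[OF fin_bad] atLeast0LessThan by metis
  define u v where "u i = Inf (snd (h i))" and "v i = Sup (snd (h i))" for i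
  have h_bad: "h i \<in> bad" if "i < n" for i using h that bij_betwE by blast
  have uv: "a \<le> u i \<and> u i \<le> v i \<and> v i \<le> b \<and> {u i<..<v i} = interior (snd (h i)) \<and> {u i<..<v i} \<subseteq> U"
    if "i < n" for i
  proof -
    obtain x K where xK: "h i = (x, K)" by fastforce
    then have "(x, K) \<in> p" "x \<in> N" using h_bad[OF that] by (auto simp: bad_def)
    note I = p_int[OF this(1)] and dU = d_bad[OF this(2)]
    have "interior K = {u i<..<v i}"
      using I interior_atLeastAtMost_real xK by (metis u_def v_def snd_conv)
    moreover have "interior K \<subseteq> U" using I dU interior_subset by blast
    ultimately show ?thesis using I xK by (auto simp: u_def v_def)
  qed
  have disj: "{u i<..<v i} \<inter> {u j<..<v j} = {}" if "i < n" "j < n" "i \<noteq> j" for i j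
  proof -
    have "h i \<noteq> h j" using h that by (auto simp: bij_betw_def inj_on_def)
    moreover have "h i \<in> p" "h j \<in> p" using h_bad bad that by auto
    ultimately have "interior (snd (h i)) \<inter> interior (snd (h j)) = {}"
      using tagged_division_ofD(5)[OF p] by (metis prod.collapse)
    then show ?thesis using uv that by simp
  qed
  \<comment> \<open>The open bad intervals are disjoint and lie in \<open>U\<close>, so their total
    length is at most the measure of \<open>U\<close>.\<close>
  have "(\<Sum>i<n. v i - u i) < \<delta>"
  proof -
    have "(\<Sum>i<n. v i - u i) = (\<Sum>i<n. measure lebesgue {u i<..<v i})"
    proof (rule sum.cong)
      fix i assume "i \<in> {..<n}"
      then have "u i \<le> v i" using uv by blast
      then show "v i - u i = measure lebesgue {u i<..<v i}" by simp
    qed simp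
    also have "\<dots> = measure lebesgue (\<Union>i<n. {u i<..<v i})"
    proof (rule measure_finite_Union[symmetric])
      show "disjoint_family_on (\<lambda>i. {u i<..<v i}) {..<n}"
        using disj by (auto simp: disjoint_family_on_def)
      show "emeasure lebesgue {u i<..<v i} \<noteq> \<infinity>" for i
        by (cases "u i \<le> v i") auto
    qed auto
    also have "ennreal \<dots> \<le> emeasure lebesgue (\<Union>i<n. {u i<..<v i})"
      by (simp add: measure_def ennreal_enn2real_if)
    also have "\<dots> \<le> emeasure lebesgue U"
      using uv U_sets by (intro emeasure_mono) auto
    also note U_less
    finally have "ennreal (\<Sum>i<n. v i - u i) < ennreal \<delta>" .
    moreover have "(\<Sum>i<n. v i - u i) \<ge> 0"
      using uv by (intro sum_nonneg) (force simp del: interior_atLeastAtMost_real)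
    ultimately show ?thesis by (simp add: ennreal_less_iff)
  qed
  then have "short_intervals a b \<delta> n u v"
    using uv disj by (auto simp: short_intervals_def)
  from \<delta>[OF this] have "(\<Sum>i<n. norm (f (v i) - f (u i))) < e / 2" .
  moreover have "(\<Sum>(x,K)\<in>bad. f (Sup K) - f (Inf K)) = (\<Sum>i<n. f (v i) - f (u i))"
    using sum.reindex_bij_betw[OF h, of "\<lambda>(x,K). f (Sup K) - f (Inf K)"]
    by (simp add: u_def v_def case_prod_unfold)
  moreover have "(\<Sum>i<n. f (v i) - f (u i)) \<le> (\<Sum>i<n. norm (f (v i) - f (u i)))"
    by (intro sum_mono) auto
  ultimately have bad_le: "(\<Sum>(x,K)\<in>bad. f (Sup K) - f (Inf K)) \<le> e / 2" by linarith
  have "(\<Sum>(x,K)\<in>p - bad. f (Sup K) - f (Inf K)) \<le> (\<Sum>(x,K)\<in>p - bad. e' * (Sup K - Inf K))"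
  proof (rule sum_mono, clarify)
    fix x K assume xK: "(x, K) \<in> p" "(x, K) \<notin> bad"
    note I = p_int[OF xK(1)]
    have "x \<in> {a..b} - N" using I xK by (auto simp: bad_def)
    moreover have "Inf K \<in> K" "Sup K \<in> K" using I by (metis atLeastAtMost_iff order.trans order.refl)+
    ultimately show "f (Sup K) - f (Inf K) \<le> e' * (Sup K - Inf K)"
      using I by (intro d_good[of x]) auto
  qed
  also have "\<dots> \<le> (\<Sum>(x,K)\<in>p. e' * (Sup K - Inf K))"
    using p_fin p_int \<open>e' > 0\<close> by (intro sum_mono2) force+
  \<comment> \<open>The lengths telescope: this is the additivity of increments over the division,
    applied to the identity.\<close>
  also have "\<dots> = e' * (b - a)"
    using additive_tagged_division_1[OF \<open>a \<le> b\<close> p, of "\<lambda>x. x"]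
    by (simp add: case_prod_unfold flip: sum_distrib_left)
  also have "\<dots> \<le> e / 2"
    using \<open>e > 0\<close> \<open>a \<le> b\<close> by (simp add: e'_def field_simps)
  finally have "(\<Sum>(x,K)\<in>p - bad. f (Sup K) - f (Inf K)) \<le> e / 2" .
  with bad_le show "f b \<le> f a + e"
    using additive_tagged_division_1[OF \<open>a \<le> b\<close> p, of f]
      sum.subset_diff[OF bad p_fin, of "\<lambda>(x,K). f (Sup K) - f (Inf K)"]
    by linarith
qed

text \<open>Subtracting \<open>k * t\<close> lowers the derivative by \<open>k\<close> and reduces
  the claim to the antitone case.\<close>

lemma abs_continuous_on_interval_increment_le:
  fixes f :: "real \<Rightarrow> real"
  assumes "a \<le> b" and f: "abs_continuous_on_interval a b f"
    and deriv: "AE t in lebesgue. t \<in> {a..b} \<longrightarrow>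
      (\<exists>f'\<le>k. (f has_real_derivative f') (at t within {a..b}))"
  shows "f b - f a \<le> k * (b - a)"
proof -
  have "\<bar>k\<bar>-lipschitz_on {a..b} (\<lambda>t. k * t)"
    by (intro lipschitz_onI) (auto simp: dist_real_def abs_mult simp flip: right_diff_distrib)
  then have "abs_continuous_on_interval a b (\<lambda>t. f t - k * t)"
    by (intro abs_continuous_on_interval_diff f abs_continuous_on_interval_lipschitz)
  moreover have "AE t in lebesgue. t \<in> {a..b} \<longrightarrow>
      (\<exists>g'\<le>0. ((\<lambda>t. f t - k * t) has_real_derivative g') (at t within {a..b}))"
    using deriv
  proof eventually_elim
    case (elim t)
    show ?case
    proof
      assume "t \<in> {a..b}"
      then obtain f' where "f' \<le> k" "(f has_real_derivative f') (at t within {a..b})"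
        using elim by blast
      then have "f' - k \<le> 0" "((\<lambda>t. f t - k * t) has_real_derivative f' - k) (at t within {a..b})"
        by (auto intro!: derivative_eq_intros)
      then show "\<exists>g'\<le>0. ((\<lambda>t. f t - k * t) has_real_derivative g') (at t within {a..b})"
        by blast
    qed
  qed
  ultimately have "f b - k * b \<le> f a - k * a"
    using abs_continuous_on_interval_antimono[OF \<open>a \<le> b\<close>] by blast
  then show ?thesis by (simp add: algebra_simps)
qed

section \<open>The scalar product and norm weighted by a positive diagonal matrix\<close>

interpretation inner_A: bounded_bilinear "inner_A A" for A :: "real^'m^'m"
  using bounded_bilinear.comp[OF bounded_bilinear_inner bounded_linear_ident
    matrix_vector_mul_bounded_linear[of A]]
  by (simp add: inner_A_def [abs_def])

lemma matrix_vector_mult_diagonal: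
  assumes "positive_diagonal A"
  shows "(A *v x) $ i = A $ i $ i * x $ i"
proof -
  have "(A *v x) $ i = (\<Sum>j\<in>UNIV. A $ i $ j * x $ j)"
    by (simp add: matrix_vector_mult_def)
  also have "\<dots> = (\<Sum>j\<in>UNIV. if j = i then A $ i $ i * x $ i else 0)"
    using assms by (intro sum.cong) (auto simp: positive_diagonal_def)
  finally show ?thesis by simp
qed

lemma inner_A_diagonal:
  assumes "positive_diagonal A"
  shows "inner_A A x y = (\<Sum>i\<in>UNIV. A $ i $ i * (x $ i * y $ i))"
  by (simp add: inner_A_def inner_vec_def matrix_vector_mult_diagonal[OF assms] algebra_simps)

lemma inner_A_commute: "positive_diagonal A \<Longrightarrow> inner_A A x y = inner_A A y x"
  by (simp add: inner_A_diagonal mult.commute)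

lemma inner_A_axis: "positive_diagonal A \<Longrightarrow> inner_A A (axis j 1) y = A $ j $ j * y $ j"
  by (simp add: inner_A_def inner_axis' matrix_vector_mult_diagonal)

lemma inner_A_nonneg: "positive_diagonal A \<Longrightarrow> inner_A A x x \<ge> 0"
  by (auto simp: inner_A_diagonal positive_diagonal_def less_imp_le intro!: sum_nonneg)

lemma inner_A_eq_0_iff:
  assumes A: "positive_diagonal A"
  shows "inner_A A x x = 0 \<longleftrightarrow> x = 0"
proof -
  have pos: "A $ i $ i > 0" for i using A by (simp add: positive_diagonal_def)
  have "inner_A A x x = 0 \<longleftrightarrow> (\<forall>i\<in>UNIV. A $ i $ i * (x $ i * x $ i) = 0)"
    unfolding inner_A_diagonal[OF A]
    using pos by (intro sum_nonneg_eq_0_iff) (auto simp: less_imp_le)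
  also have "\<dots> \<longleftrightarrow> x = 0"
    using pos by (auto simp: vec_eq_iff less_imp_neq[THEN not_sym])
  finally show ?thesis .
qed

lemma norm_A_nonneg: "positive_diagonal A \<Longrightarrow> norm_A A x \<ge> 0"
  by (simp add: norm_A_def inner_A_nonneg)

lemma norm_A_eq_0_iff: "positive_diagonal A \<Longrightarrow> norm_A A x = 0 \<longleftrightarrow> x = 0"
  by (simp add: norm_A_def inner_A_eq_0_iff)

lemma norm_A_power2: "positive_diagonal A \<Longrightarrow> (norm_A A x)\<^sup>2 = inner_A A x x"
  by (simp add: norm_A_def inner_A_nonneg)

lemma norm_A_scaleR: "norm_A A (c *\<^sub>R x) = \<bar>c\<bar> * norm_A A x"
  by (simp add: norm_A_def inner_A.scaleR_left inner_A.scaleR_right real_sqrt_mult flip: mult.assoc)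

lemma has_real_derivative_inner_A_square:
  assumes A: "positive_diagonal A" and w: "(w has_vector_derivative w') (at t within S)"
  shows "((\<lambda>t. inner_A A (w t) (w t)) has_real_derivative 2 * inner_A A w' (w t)) (at t within S)"
  using inner_A.has_vector_derivative[OF w w, of A] inner_A_commute[OF A, of w' "w t"]
  by (simp add: has_real_derivative_iff_has_vector_derivative)

section \<open>Decay of the weighted norm along a curve\<close>

text \<open>The square of the norm has derivative \<open>2 * inner_A A w' (w t)\<close>. Using the
  square instead of the norm avoids the failure of differentiability at zeros of
  \<open>w\<close>.\<close>

lemma inner_A_square_antimono:
  assumes A: "positive_diagonal A" and "a \<le> b" and w: "abs_continuous_on_interval a b w"
    and deriv: "AE t in lebesgue. t \<in> {a..b} \<longrightarrow>
      (\<exists>w'. (w has_vector_derivative w') (at t within {a..b}) \<and> inner_A A w' (w t) \<le> 0)"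
  shows "inner_A A (w b) (w b) \<le> inner_A A (w a) (w a)"
proof (rule abs_continuous_on_interval_antimono[OF \<open>a \<le> b\<close>])
  show "abs_continuous_on_interval a b (\<lambda>t. inner_A A (w t) (w t))"
    by (rule abs_continuous_on_interval_bilinear_square[OF inner_A.bounded_bilinear_axioms w])
  show "AE t in lebesgue. t \<in> {a..b} \<longrightarrow> (\<exists>f'\<le>0.
      ((\<lambda>t. inner_A A (w t) (w t)) has_real_derivative f') (at t within {a..b}))"
    using deriv
  proof eventually_elim
    case (elim t)
    show ?case
    proof
      assume "t \<in> {a..b}"
      with elim obtain w' where "(w has_vector_derivative w') (at t within {a..b})"
        and "2 * inner_A A w' (w t) \<le> 0" by auto
      with has_real_derivative_inner_A_square[OF A]
      show "\<exists>f'\<le>0. ((\<lambda>t. inner_A A (w t) (w t)) has_real_derivative f') (at t within {a..b})"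
        by blast
    qed
  qed
qed

text \<open>If \<open>w \<tau>\<close> were nonzero, the norm \<open>r\<close> would stay above
  \<open>r \<tau> > 0\<close> on the whole interval. There the square root is smooth, so
  \<open>r\<close> is absolutely continuous with derivative at most \<open>-\<epsilon>\<close>
  almost everywhere, and integration gives
  \<open>r \<tau> \<le> r 0 - \<epsilon> * \<tau> \<le> 0\<close>.\<close>

lemma reaches_zero_in_finite_time:
  assumes A: "positive_diagonal A" and "\<epsilon> \<ge> 0" "\<tau> \<ge> 0"
    and w: "abs_continuous_on_interval 0 \<tau> w"
    and deriv: "AE t in lebesgue. t \<in> {0..\<tau>} \<longrightarrow>
      (\<exists>w'. (w has_vector_derivative w') (at t within {0..\<tau>}) \<and>
            inner_A A w' (w t) \<le> - \<epsilon> * norm_A A (w t))"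
    and init: "norm_A A (w 0) \<le> \<epsilon> * \<tau>"
  shows "w \<tau> = 0"
proof (rule ccontr)
  assume "w \<tau> \<noteq> 0"
  define r where "r t = norm_A A (w t)" for t
  have "r \<tau> > 0"
    using \<open>w \<tau> \<noteq> 0\<close> norm_A_eq_0_iff[OF A] norm_A_nonneg[OF A] unfolding r_def
    by (metis less_eq_real_def)
  have r_ge: "r \<tau> \<le> r t" if t: "t \<in> {0..\<tau>}" for t
  proof -
    have "inner_A A (w \<tau>) (w \<tau>) \<le> inner_A A (w t) (w t)"
    proof (rule inner_A_square_antimono[OF A])
      show "abs_continuous_on_interval t \<tau> w"
        using t by (intro abs_continuous_on_interval_subset[OF w]) auto
      show "AE s in lebesgue. s \<in> {t..\<tau>} \<longrightarrow>
          (\<exists>w'. (w has_vector_derivative w') (at s within {t..\<tau>}) \<and> inner_A A w' (w s) \<le> 0)"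
        using deriv
      proof eventually_elim
        case (elim s)
        show ?case
        proof
          assume s: "s \<in> {t..\<tau>}"
          then obtain w' where w': "(w has_vector_derivative w') (at s within {0..\<tau>})"
            "inner_A A w' (w s) \<le> - \<epsilon> * norm_A A (w s)" using elim t by auto
          have "(w has_vector_derivative w') (at s within {t..\<tau>})"
            using t by (intro has_vector_derivative_within_subset[OF w'(1)]) auto
          moreover have "inner_A A w' (w s) \<le> 0"
            using w'(2) mult_nonneg_nonneg[OF \<open>\<epsilon> \<ge> 0\<close> norm_A_nonneg[OF A, of "w s"]] by linarith
          ultimately show "\<exists>w'. (w has_vector_derivative w') (at s within {t..\<tau>}) \<and> inner_A A w' (w s) \<le> 0"
            by blast
        qed
      qed
    qed (use t in auto)
    then show ?thesis by (simp add: r_def norm_A_def)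
  qed
  have "r \<tau> - r 0 \<le> - \<epsilon> * (\<tau> - 0)"
  proof (rule abs_continuous_on_interval_increment_le[OF \<open>\<tau> \<ge> 0\<close>])
    show "abs_continuous_on_interval 0 \<tau> r"
    proof (rule abs_continuous_on_interval_dominated)
      show "abs_continuous_on_interval 0 \<tau> (\<lambda>t. inner_A A (w t) (w t))"
        by (rule abs_continuous_on_interval_bilinear_square[OF inner_A.bounded_bilinear_axioms w])
      fix u v assume uv: "u \<in> {0..\<tau>}" "v \<in> {0..\<tau>}"
      then have ge: "r \<tau> \<le> r u" "r \<tau> \<le> r v" by (auto intro: r_ge)
      \<comment> \<open>Factoring the difference of squares, with
        \<open>r v + r u \<ge> r \<tau>\<close>, bounds the increments of \<open>r\<close> by those
        of its square.\<close>
      have "r \<tau> * \<bar>r v - r u\<bar> \<le> (r v + r u) * \<bar>r v - r u\<bar>"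
        using ge \<open>r \<tau> > 0\<close> by (intro mult_right_mono) auto
      also have "\<dots> = \<bar>(r v + r u) * (r v - r u)\<bar>"
        using ge \<open>r \<tau> > 0\<close> by (simp add: abs_mult)
      also have "\<dots> = \<bar>(r v)\<^sup>2 - (r u)\<^sup>2\<bar>"
        by (simp add: power2_eq_square algebra_simps)
      finally show "norm (r v - r u) \<le> 1 / r \<tau> * norm (inner_A A (w v) (w v) - inner_A A (w u) (w u))"
        using \<open>r \<tau> > 0\<close> by (simp add: r_def norm_A_power2[OF A] field_simps)
    qed
    show "AE t in lebesgue. t \<in> {0..\<tau>} \<longrightarrow>
        (\<exists>r'\<le>-\<epsilon>. (r has_real_derivative r') (at t within {0..\<tau>}))"
      using deriv
    proof eventually_elim
      case (elim t)
      show ?case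
      proof
        assume t: "t \<in> {0..\<tau>}"
        then obtain w' where w': "(w has_vector_derivative w') (at t within {0..\<tau>})"
          "inner_A A w' (w t) \<le> - \<epsilon> * r t" using elim by (auto simp: r_def)
        have "r t > 0" using r_ge[OF t] \<open>r \<tau> > 0\<close> by simp
        then have "inner_A A (w t) (w t) > 0" by (simp add: r_def norm_A_def)
        \<comment> \<open>The factor 2 from the square cancels against the one in the derivative of
          the square root.\<close>
        from DERIV_chain2[OF DERIV_real_sqrt[OF this] has_real_derivative_inner_A_square[OF A w'(1)]]
        have "(r has_real_derivative inner_A A w' (w t) / r t) (at t within {0..\<tau>})"
          by (simp add: r_def [abs_def] norm_A_def field_simps)
        moreover have "inner_A A w' (w t) / r t \<le> - \<epsilon>"
          using w'(2) \<open>r t > 0\<close> by (simp add: field_simps)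
        ultimately show "\<exists>r'\<le>-\<epsilon>. (r has_real_derivative r') (at t within {0..\<tau>})" by blast
      qed
    qed
  qed
  with init \<open>r \<tau> > 0\<close> show False by (simp add: r_def)
qed

section \<open>Uniqueness and time shifts of solutions of the sweeping process\<close>

lemma sweeping_solution_unique:
  assumes A: "positive_diagonal A"
    and y: "sweeping_solution V A K t0 y" and z: "sweeping_solution V A K t0 z"
    and init: "y t0 = z t0" and "t \<ge> t0"
  shows "y t = z t"
proof -
  let ?w = "\<lambda>s. y s - z s"
  have "inner_A A (?w t) (?w t) \<le> inner_A A (?w t0) (?w t0)"
  proof (rule inner_A_square_antimono[OF A \<open>t \<ge> t0\<close>])
    show "abs_continuous_on_interval t0 t ?w"
      using y z \<open>t \<ge> t0\<close> unfolding sweeping_solution_def locally_abs_continuous_from_def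
      by (intro abs_continuous_on_interval_diff) auto
    have "AE s in lebesgue. s \<ge> t0 \<longrightarrow> (\<exists>y'. (y has_vector_derivative y') (at s within {t0..}) \<and>
        - y' \<in> normal_cone_A V A (K s) (y s))"
      and "AE s in lebesgue. s \<ge> t0 \<longrightarrow> (\<exists>z'. (z has_vector_derivative z') (at s within {t0..}) \<and>
        - z' \<in> normal_cone_A V A (K s) (z s))"
      using y z by (auto simp: sweeping_solution_def)
    then show "AE s in lebesgue. s \<in> {t0..t} \<longrightarrow>
        (\<exists>w'. (?w has_vector_derivative w') (at s within {t0..t}) \<and> inner_A A w' (?w s) \<le> 0)"
    proof eventually_elim
      case (elim s)
      show ?case
      proof
        assume s: "s \<in> {t0..t}"
        obtain y' z' where y': "(y has_vector_derivative y') (at s within {t0..})"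
            "- y' \<in> normal_cone_A V A (K s) (y s)"
          and z': "(z has_vector_derivative z') (at s within {t0..})"
            "- z' \<in> normal_cone_A V A (K s) (z s)"
          using elim s by auto
        have "y s \<in> K s" "z s \<in> K s"
          using y z s by (auto simp: sweeping_solution_def)
        \<comment> \<open>Each solution is the test point in the inclusion of the other; the sum of
          the two inequalities is monotonicity of the normal cone.\<close>
        then have "inner_A A (- y') (z s - y s) \<le> 0" "inner_A A (- z') (y s - z s) \<le> 0"
          using y'(2) z'(2) by (auto simp: normal_cone_A_def)
        then have "inner_A A (y' - z') (?w s) \<le> 0"
          by (simp add: inner_A.minus_left inner_A.diff_left inner_A.diff_right)
        moreover have "(?w has_vector_derivative y' - z') (at s within {t0..t})"
          by (intro has_vector_derivative_diff has_vector_derivative_within_subset[OF y'(1)]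
              has_vector_derivative_within_subset[OF z'(1)]) auto
        ultimately show "\<exists>w'. (?w has_vector_derivative w') (at s within {t0..t}) \<and> inner_A A w' (?w s) \<le> 0"
          by blast
      qed
    qed
  qed
  then have "inner_A A (?w t) (?w t) = 0"
    using init inner_A_nonneg[OF A, of "?w t"] by (simp add: inner_A.zero_left)
  then show ?thesis by (simp add: inner_A_eq_0_iff[OF A])
qed

text \<open>Serves two purposes: \<open>T = 0\<close> restricts a solution to a later starting time,
  and a period \<open>T\<close> of the moving set brings a solution back to an earlier one.\<close>

lemma sweeping_solution_shift:
  assumes y: "sweeping_solution V A K t0 y"
    and K: "\<And>t. t \<ge> t1 \<Longrightarrow> K (t + T) = K' t" and "t0 \<le> t1 + T"
  shows "sweeping_solution V A K' t1 (\<lambda>t. y (t + T))"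
  unfolding sweeping_solution_def
proof (intro conjI allI impI)
  show "locally_abs_continuous_from t1 (\<lambda>t. y (t + T))"
    using y \<open>t0 \<le> t1 + T\<close> unfolding sweeping_solution_def locally_abs_continuous_from_def
    by (auto intro!: abs_continuous_on_interval_shift)
  show "y (t + T) \<in> V" if "t1 \<le> t" for t
    using y that \<open>t0 \<le> t1 + T\<close> by (simp add: sweeping_solution_def)
  show "y (t + T) \<in> K' t" if "t1 \<le> t" for t
    using y that \<open>t0 \<le> t1 + T\<close> by (simp add: sweeping_solution_def flip: K)
  have "AE t in lebesgue. t \<ge> t0 \<longrightarrow> (\<exists>y'. (y has_vector_derivative y') (at t within {t0..}) \<and>
      - y' \<in> normal_cone_A V A (K t) (y t))"
    using y by (auto simp: sweeping_solution_def)
  from AE_lebesgue_shift[OF this, of T]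
  show "AE t in lebesgue. t1 \<le> t \<longrightarrow>
      (\<exists>y'. ((\<lambda>t. y (t + T)) has_vector_derivative y') (at t within {t1..}) \<and>
        - y' \<in> normal_cone_A V A (K' t) (y (t + T)))"
  proof eventually_elim
    case (elim t)
    show ?case
    proof
      assume "t1 \<le> t"
      with elim \<open>t0 \<le> t1 + T\<close>
      obtain y' where y': "(y has_vector_derivative y') (at (t + T) within {t0..})"
        "- y' \<in> normal_cone_A V A (K (t + T)) (y (t + T))" by auto
      \<comment> \<open>The translated half-line lies in \<open>{t0..}\<close>, so the one-sided
        derivative may be restricted to it before the chain rule is applied.\<close>
      have "(y has_vector_derivative y') (at (t + T) within (\<lambda>t. t + T) ` {t1..})"
        using y'(1) by (rule has_vector_derivative_within_subset) (use \<open>t0 \<le> t1 + T\<close> in auto)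
      moreover have "((\<lambda>t. t + T) has_vector_derivative 1) (at t within {t1..})"
        by (auto intro!: derivative_eq_intros)
      ultimately have "((\<lambda>t. y (t + T)) has_vector_derivative y') (at t within {t1..})"
        using vector_diff_chain_within[of "\<lambda>t. t + T" 1 t "{t1..}" y y'] by (simp add: o_def)
      then show "\<exists>y'. ((\<lambda>t. y (t + T)) has_vector_derivative y') (at t within {t1..}) \<and>
          - y' \<in> normal_cone_A V A (K' t) (y (t + T))"
        using y'(2) K[OF \<open>t1 \<le> t\<close>] by auto
    qed
  qed
qed

section \<open>Arrival at the vertex in finite time\<close>

text \<open>For diagonal \<open>A\<close> the constraints bound each coordinate separately, so the
  set is a closed subspace intersected with a box. Compactness makes the maximum in the definition
  of \<open>\<tau>\<close> exist.\<close>

lemma compact_constraint_set: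
  assumes V: "subspace V" and A: "positive_diagonal A"
  shows "compact (constraint_set V A cm cp)"
proof -
  have pos: "A $ i $ i > 0" for i using A by (simp add: positive_diagonal_def)
  have "constraint_set V A cm cp = V \<inter> cbox (\<chi> j. cm j / A $ j $ j) (\<chi> j. cp j / A $ j $ j)"
    using pos by (auto simp: constraint_set_def inner_A_axis[OF A] mem_box_cart field_simps)
  then show ?thesis using V by (simp add: closed_Int_compact closed_subspace)
qed

text \<open>The initial value \<open>w 0\<close> is \<open>v - y0\<close> for some \<open>v\<close>
  in \<open>C\<close>, so by \<open>radius\<close> its norm is used up by time \<open>\<tau>\<close>
  when it decays at rate \<open>\<epsilon>\<close>.\<close>

lemma sweeping_solution_reaches_vertex:
  assumes A: "positive_diagonal A" and V: "subspace V"
    and c: "L-lipschitz_on {0..} c"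
    and "C \<subseteq> V" "y0 \<in> C" "\<epsilon> > 0" "\<tau> \<ge> 0"
    and radius: "\<And>v. v \<in> C \<Longrightarrow> norm_A A (v - y0) \<le> \<epsilon> * \<tau>"
    and normal: "AE t in lebesgue. t \<in> {0..\<tau>} \<longrightarrow>
           (\<exists>c'. (c has_vector_derivative c') (at t within {0..}) \<and>
                 (\<forall>b \<in> cball_A V A \<epsilon>. - c' + b \<in> normal_cone_A V A C y0))"
    and y: "sweeping_solution V A (moving_set C c) 0 y"
  shows "y \<tau> = y0 + c \<tau>"
proof -
  define w where "w t = y t - c t - y0" for t
  have yC: "y t - c t \<in> C" if "t \<ge> 0" for t
  proof -
    have "y t \<in> moving_set C c t" using y that by (simp add: sweeping_solution_def)
    then show ?thesis by (auto simp: moving_set_def)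
  qed
  have "w \<tau> = 0"
  proof (rule reaches_zero_in_finite_time[OF A])
    have "abs_continuous_on_interval 0 \<tau> y"
      using y \<open>\<tau> \<ge> 0\<close> by (simp add: sweeping_solution_def locally_abs_continuous_from_def)
    moreover have "abs_continuous_on_interval 0 \<tau> c"
      using c by (intro abs_continuous_on_interval_lipschitz) (auto intro: lipschitz_on_subset)
    moreover have "abs_continuous_on_interval 0 \<tau> (\<lambda>t. y0)"
      by (intro abs_continuous_on_interval_lipschitz[of 0] lipschitz_intros)
    ultimately show "abs_continuous_on_interval 0 \<tau> w"
      unfolding w_def by (intro abs_continuous_on_interval_diff)
    show "norm_A A (w 0) \<le> \<epsilon> * \<tau>"
      using radius[OF yC[of 0]] by (simp add: w_def)
    have "AE t in lebesgue. t \<ge> 0 \<longrightarrow> (\<exists>y'. (y has_vector_derivative y') (at t within {0..}) \<and>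
        - y' \<in> normal_cone_A V A (moving_set C c t) (y t))"
      using y by (auto simp: sweeping_solution_def)
    with normal show "AE t in lebesgue. t \<in> {0..\<tau>} \<longrightarrow>
      (\<exists>w'. (w has_vector_derivative w') (at t within {0..\<tau>}) \<and>
            inner_A A w' (w t) \<le> - \<epsilon> * norm_A A (w t))"
    proof eventually_elim
      case (elim t)
      show ?case
      proof
        assume t: "t \<in> {0..\<tau>}"
        obtain y' c' where y': "(y has_vector_derivative y') (at t within {0..})"
            "- y' \<in> normal_cone_A V A (moving_set C c t) (y t)"
          and c': "(c has_vector_derivative c') (at t within {0..})"
            "\<And>b. b \<in> cball_A V A \<epsilon> \<Longrightarrow> - c' + b \<in> normal_cone_A V A C y0"
          using elim t by auto
        have x: "y t - c t \<in> C" using t by (intro yC) simp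
        \<comment> \<open>The translated vertex is an admissible test point, and its difference from
          \<open>y t\<close> is \<open>- w t\<close>.\<close>
        have "y0 + c t \<in> moving_set C c t"
          using \<open>y0 \<in> C\<close> by (auto simp: moving_set_def)
        then have "inner_A A (- y') (y0 + c t - y t) \<le> 0"
          using y'(2) by (auto simp: normal_cone_A_def split: if_splits)
        then have y'_le: "inner_A A y' (w t) \<le> 0"
          by (simp add: w_def inner_A.minus_left inner_A.diff_right inner_A.add_right)
        have "w t \<in> V"
          unfolding w_def using x \<open>y0 \<in> C\<close> \<open>C \<subseteq> V\<close> by (blast intro: subspace_diff[OF V])
        \<comment> \<open>For \<open>w t = 0\<close> this is the zero vector, as division by zero yields zero.\<close>
        define b where "b = (\<epsilon> / norm_A A (w t)) *\<^sub>R w t"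
        have "norm_A A b \<le> \<epsilon>"
          using \<open>\<epsilon> > 0\<close> norm_A_nonneg[OF A, of "w t"] by (simp add: b_def norm_A_scaleR)
        then have "b \<in> cball_A V A \<epsilon>"
          using V \<open>w t \<in> V\<close> by (simp add: cball_A_def b_def subspace_scale)
        \<comment> \<open>The test point is \<open>y t - c t\<close>, whose difference from
          \<open>y0\<close> is \<open>w t\<close>.\<close>
        from c'(2)[OF this] x have "inner_A A (- c' + b) (w t) \<le> 0"
          by (auto simp: normal_cone_A_def w_def split: if_splits)
        moreover have "inner_A A b (w t) = \<epsilon> * norm_A A (w t)"
          by (simp add: b_def inner_A.scaleR_left power2_eq_square flip: norm_A_power2[OF A])
        ultimately have "inner_A A (y' - c') (w t) \<le> - \<epsilon> * norm_A A (w t)"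
          using y'_le by (simp add: inner_A.add_left inner_A.minus_left inner_A.diff_left)
        moreover have "((\<lambda>t. y t - c t - y0) has_vector_derivative y' - c' - 0) (at t within {0..\<tau>})"
          by (intro has_vector_derivative_diff has_vector_derivative_const
              has_vector_derivative_within_subset[OF y'(1)]
              has_vector_derivative_within_subset[OF c'(1)]) auto
        ultimately show "\<exists>w'. (w has_vector_derivative w') (at t within {0..\<tau>}) \<and>
            inner_A A w' (w t) \<le> - \<epsilon> * norm_A A (w t)"
          unfolding w_def by auto
      qed
    qed
  qed (use \<open>\<epsilon> > 0\<close> \<open>\<tau> \<ge> 0\<close> in auto)
  then show ?thesis by (simp add: w_def algebra_simps)
qed

section \<open>Global one-period stability of the periodic solution\<close>

theorem corollary1:
  fixes V :: "(real^'m) set" and d :: nat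
    and A :: "real^'m^'m"
    and c :: "real \<Rightarrow> real^'m"
    and cm cp :: "'m \<Rightarrow> real"
    and C :: "(real^'m) set"
    and I0 :: "(int \<times> 'm) set"
    and y0 :: "real^'m"
    and \<epsilon> \<tau> :: real
  assumes "subspace V" and "dim V = d"
    and "positive_diagonal A"
    and "\<forall>t\<ge>0. c t \<in> V"
    and "\<exists>L. L-lipschitz_on {0..} c"
    and C_def: "C = constraint_set V A cm cp"
    and "I0 \<subseteq> {-1, 1} \<times> UNIV"
    and "face_set V A cm cp I0 = {y0}"
    and "y0 \<in> C"
    and "\<epsilon> > 0"
    and tau_def: "\<tau> = 1 / \<epsilon> * (GREATEST r. r \<in> (\<lambda>v. norm_A A (v - y0)) ` C)"
    and "AE t in lebesgue. t \<in> {0..\<tau>} \<longrightarrow>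
           (\<exists>c'. (c has_vector_derivative c') (at t within {0..}) \<and>
                 (\<forall>b \<in> cball_A V A \<epsilon>. - c' + b \<in> normal_cone_A V A C y0))"
  shows "(\<forall>y. sweeping_solution V A (moving_set C c) 0 y \<longrightarrow> y 0 \<in> moving_set C c 0 \<longrightarrow>
             y \<tau> = y0 + c \<tau>) \<and>
         (\<forall>ys T. sweeping_solution V A (moving_set C c) \<tau> ys \<longrightarrow> ys \<tau> = y0 + c \<tau> \<longrightarrow>
             (\<forall>t\<ge>0. c (t + T) = c t) \<longrightarrow> T \<ge> \<tau> \<longrightarrow>
             globally_one_period_stable_periodic V A (moving_set C c) \<tau> T ys)"
proof -
  have CV: "C \<subseteq> V" by (auto simp: C_def constraint_set_def)
  have "continuous_on C (\<lambda>v. norm_A A (v - y0))"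
    unfolding norm_A_def by (intro continuous_intros inner_A.continuous_on)
  then obtain v0 where "v0 \<in> C" and v0: "\<And>v. v \<in> C \<Longrightarrow> norm_A A (v - y0) \<le> norm_A A (v0 - y0)"
    using continuous_attains_sup[of C "\<lambda>v. norm_A A (v - y0)"] \<open>y0 \<in> C\<close>
      compact_constraint_set[OF assms(1,3)] unfolding C_def by blast
  \<comment> \<open>\<open>GREATEST\<close> denotes the maximum because it is attained, at
    \<open>v0\<close>; hence \<open>\<epsilon> * \<tau>\<close> is the radius of \<open>C\<close>
    about \<open>y0\<close>.\<close>
  then have "(GREATEST r. r \<in> (\<lambda>v. norm_A A (v - y0)) ` C) = norm_A A (v0 - y0)"
    by (intro Greatest_equality) auto
  then have \<tau>: "\<epsilon> * \<tau> = norm_A A (v0 - y0)" "\<tau> \<ge> 0"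
    using tau_def \<open>\<epsilon> > 0\<close> norm_A_nonneg[OF assms(3)] by auto
  obtain L where L: "L-lipschitz_on {0..} c" using assms(5) by blast
  have reach: "y \<tau> = y0 + c \<tau>" if "sweeping_solution V A (moving_set C c) 0 y" for y
    by (rule sweeping_solution_reaches_vertex[OF assms(3,1) L CV \<open>y0 \<in> C\<close>
          \<open>\<epsilon> > 0\<close> \<tau>(2) _ assms(12) that])
      (use v0 \<tau>(1) in auto)
  have "globally_one_period_stable_periodic V A (moving_set C c) \<tau> T ys"
    if ys: "sweeping_solution V A (moving_set C c) \<tau> ys" "ys \<tau> = y0 + c \<tau>"
      and per: "\<forall>t\<ge>0. c (t + T) = c t" and "T \<ge> \<tau>" for ys T
    unfolding globally_one_period_stable_periodic_def
  proof (intro conjI allI impI)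
    \<comment> \<open>Every solution from time 0 passes through the vertex at time
      \<open>\<tau>\<close>, where it meets \<open>ys\<close>; uniqueness continues the
      agreement.\<close>
    have eq_ys: "y t = ys t" if y: "sweeping_solution V A (moving_set C c) 0 y" and "t \<ge> \<tau>" for y t
    proof (rule sweeping_solution_unique[OF assms(3) _ ys(1) _ \<open>t \<ge> \<tau>\<close>])
      show "sweeping_solution V A (moving_set C c) \<tau> y"
        using sweeping_solution_shift[OF y, of \<tau> 0] \<open>\<tau> \<ge> 0\<close> by simp
      show "y \<tau> = ys \<tau>" using reach[OF y] ys(2) by simp
    qed
    show "sweeping_solution V A (moving_set C c) \<tau> ys" by (rule ys)
    have "moving_set C c (t + T) = moving_set C c t" if "t \<ge> 0" for t
      using per that by (simp add: moving_set_def)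
    \<comment> \<open>As \<open>T \<ge> \<tau>\<close>, the shifted curve reads \<open>ys\<close>
      only where it is a solution. It thus solves the process from time 0, and \<open>eq_ys\<close>
      applied to it is the periodicity of \<open>ys\<close>.\<close>
    then have "sweeping_solution V A (moving_set C c) 0 (\<lambda>t. ys (t + T))"
      using \<open>T \<ge> \<tau>\<close> by (intro sweeping_solution_shift[OF ys(1)]) auto
    from eq_ys[OF this] show "ys (t + T) = ys t" if "t \<ge> \<tau>" for t using that .
    show "y t = ys t" if "sweeping_solution V A (moving_set C c) 0 y" "t \<ge> T" for y t
      using eq_ys that \<open>T \<ge> \<tau>\<close> by auto
  qed
  with reach show ?thesis by blast
qed

end
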